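(* Let $n\ge 2$ and let $\mathcal{A}_n$ be the set of arrays defined below. For any $A\in\mathcal{A}_n$, $A$ can be reconstructed from the answers to the queries $\mathsf{RMin}(i,j,q)$ and $\mathsf{RMax}(i,j,q)$ on $A$ (over all $1\le i\le j\le n$ and $q\ge1$); equivalently, any two distinct arrays in $\mathcal{A}_n$ differ in the answer to at least one such query.
   Context: A permutation $\pi$ of $\{1,\dots,m\}$ is a Baxter permutation if it avoids the patterns $2\text{-}41\text{-}3$ and $3\text{-}14\text{-}2$: there are no indices $a<b<b+1<c$ with $\pi(b+1)<\pi(a)<\pi(c)<\pi(b)$, and no indices $a<b<b+1<c$ with $\pi(b)<\pi(c)<\pi(a)<\pi(b+1)$. $\mathcal{A}_n$ is the set of all arrays $A[1..n]$ obtained as follows: choose $0\le k\le n-1$ and a set $P$ of $k$ positions in $\{2,\dots,n\}$; place a Baxter permutation of size $n-k$ (values $1,\dots,n-k$) in order on the $n-k$ positions of $\{1,\dots,n\}\setminus P$; then each position in $P$ is assigned the value at the nearest position of $\{1,\dots,n\}\setminus P$ to its left. Queries: for an interval $[i,j]$, let $i\le p_1<\dots<p_k\le j$ be all positions of the minimum value of $A[i..j]$; $\mathsf{RMin}(i,j,q)$ returns $p_q$ (or $p_k$ if $q>k$); $\mathsf{RMax}(i,j,q)$ is analogous with maximum. *)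

theory Defs
  imports "HOL-Library.FuncSet" "HOL-Combinatorics.Permutations"
begin

text \<open>
  A permutation of \<open>{1..m}\<close> is a function on \<open>nat\<close> that is the identity outside \<open>{1..m}\<close>, so the
  pattern conditions bound the indices explicitly.
\<close>

definition baxter :: "nat \<Rightarrow> (nat \<Rightarrow> nat) \<Rightarrow> bool" where
  "baxter m \<pi> \<longleftrightarrow>
     \<pi> permutes {1..m} \<and>
     \<not> (\<exists>a b c. 1 \<le> a \<and> a < b \<and> b + 1 < c \<and> c \<le> m \<and>
          \<pi> (b + 1) < \<pi> a \<and> \<pi> a < \<pi> c \<and> \<pi> c < \<pi> b) \<and>
     \<not> (\<exists>a b c. 1 \<le> a \<and> a < b \<and> b + 1 < c \<and> c \<le> m \<and>
          \<pi> b < \<pi> c \<and> \<pi> c < \<pi> a \<and> \<pi> a < \<pi> (b + 1))"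

text \<open>
  An array \<open>A[1..n]\<close> is a function that is \<open>undefined\<close> outside \<open>{1..n}\<close>, so that equality of arrays
  is equality on \<open>{1..n}\<close>. The equation between lists says that the entries of \<open>A\<close> at the
  positions outside \<open>P\<close>, read from left to right, are \<open>\<pi> 1, \<dots>, \<pi> (n - k)\<close>.
\<close>

definition baxter_arrays :: "nat \<Rightarrow> (nat \<Rightarrow> nat) set" where
  "baxter_arrays n =
     {A \<in> extensional {1..n}.
        \<exists>k P \<pi>. k < n \<and> P \<subseteq> {2..n} \<and> card P = k \<and> baxter (n - k) \<pi> \<and>
          map A (sorted_list_of_set ({1..n} - P)) = map \<pi> [1..<n - k + 1] \<and>
          (\<forall>p\<in>P. A p = A (Max {p' \<in> {1..n} - P. p' < p}))}"

definition min_positions :: "(nat \<Rightarrow> nat) \<Rightarrow> nat \<Rightarrow> nat \<Rightarrow> nat list" where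
  "min_positions A i j = sorted_list_of_set {p \<in> {i..j}. A p = Min (A ` {i..j})}"

definition max_positions :: "(nat \<Rightarrow> nat) \<Rightarrow> nat \<Rightarrow> nat \<Rightarrow> nat list" where
  "max_positions A i j = sorted_list_of_set {p \<in> {i..j}. A p = Max (A ` {i..j})}"

text \<open>
  Positions are counted from \<open>q = 1\<close>, whereas list indexing starts at \<open>0\<close>.
\<close>

definition RMin :: "(nat \<Rightarrow> nat) \<Rightarrow> nat \<Rightarrow> nat \<Rightarrow> nat \<Rightarrow> nat" where
  "RMin A i j q = (let ps = min_positions A i j in ps ! (min q (length ps) - 1))"

definition RMax :: "(nat \<Rightarrow> nat) \<Rightarrow> nat \<Rightarrow> nat \<Rightarrow> nat \<Rightarrow> nat" where
  "RMax A i j q = (let ps = max_positions A i j in ps ! (min q (length ps) - 1))"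

definition queries :: "nat \<Rightarrow> (nat \<times> nat \<times> nat) set" where
  "queries n = {(i, j, q). 1 \<le> i \<and> i \<le> j \<and> j \<le> n \<and> 1 \<le> q}"

text \<open>
  The restriction to \<open>queries n\<close> ensures that the table of answers carries no other information
  about the array.
\<close>

definition answers :: "nat \<Rightarrow> (nat \<Rightarrow> nat) \<Rightarrow> nat \<times> nat \<times> nat \<Rightarrow> nat \<times> nat" where
  "answers n A = (\<lambda>(i, j, q) \<in> queries n. (RMin A i j q, RMax A i j q))"

end

theory Submission
  imports Defs
begin

text \<open>
  The relative order of \<open>A i\<close> and \<open>A j\<close> is determined by induction on \<open>j - i\<close>. If \<open>i\<close> or \<open>j\<close> is an
  extremal position of \<open>[i, j]\<close>, the queries on \<open>[i, j]\<close> decide it. Otherwise let the minimum be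
  attained at \<open>x\<close> and the maximum at \<open>y\<close>, both strictly between \<open>i\<close> and \<open>j\<close>, and suppose \<open>x < y\<close>. If
  \<open>A i > A j\<close>, then on the way up from \<open>x\<close> to \<open>y\<close> the array cannot jump from below \<open>A j\<close> to above \<open>A i\<close>,
  as this would be the pattern \<open>3-14-2\<close>; so some \<open>z\<close> between has \<open>A j < A z < A i\<close>. By induction every
  array with the same answers has these two inequalities, so it has the same order at \<open>i\<close>
  and \<open>j\<close>. The case \<open>y < x\<close> is dual. Finally, the values of \<open>A\<close> fill an initial segment, so \<open>A\<close> is
  determined by its relative order.
\<close>

section \<open>Intermediate values forced by pattern avoidance\<close>

text \<open>The value type is an arbitrary linear order so that the condition also applies to a
  negated array, whose values are integers.\<close>

definition avoids_3_14_2 :: "nat \<Rightarrow> (nat \<Rightarrow> 'a::linorder) \<Rightarrow> bool" where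
  "avoids_3_14_2 n A \<longleftrightarrow>
     (\<forall>a b c. 1 \<le> a \<longrightarrow> a < b \<longrightarrow> b + 1 < c \<longrightarrow> c \<le> n \<longrightarrow>
        \<not> (A b < A c \<and> A c < A a \<and> A a < A (b + 1)))"

definition avoids_2_41_3 :: "nat \<Rightarrow> (nat \<Rightarrow> 'a::linorder) \<Rightarrow> bool" where
  "avoids_2_41_3 n A \<longleftrightarrow>
     (\<forall>a b c. 1 \<le> a \<longrightarrow> a < b \<longrightarrow> b + 1 < c \<longrightarrow> c \<le> n \<longrightarrow>
        \<not> (A (b + 1) < A a \<and> A a < A c \<and> A c < A b))"

text \<open>Stands in for the injectivity of a permutation: it excludes the ties that the strict
  inequalities of the patterns leave open.\<close>

definition interval_levels :: "nat \<Rightarrow> (nat \<Rightarrow> 'a) \<Rightarrow> bool" where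
  "interval_levels n A \<longleftrightarrow>
     (\<forall>i p j. 1 \<le> i \<longrightarrow> i \<le> p \<longrightarrow> p \<le> j \<longrightarrow> j \<le> n \<longrightarrow> A i = A j \<longrightarrow> A p = A i)"

lemma interval_levelsD:
  "interval_levels n A \<Longrightarrow> A i = A j \<Longrightarrow> 1 \<le> i \<Longrightarrow> i \<le> p \<Longrightarrow> p \<le> j \<Longrightarrow> j \<le> n \<Longrightarrow> A p = A i"
  unfolding interval_levels_def by blast

text \<open>The witness follows the last position \<open>b\<close> in \<open>{x..y}\<close> with
  value at most \<open>A j\<close>: if \<open>A (b + 1)\<close> exceeded \<open>A i\<close>, the
  positions \<open>i\<close>, \<open>b\<close>, \<open>b + 1\<close>, \<open>j\<close> would form
  3-14-2.\<close>

lemma intermediate_ascending: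
  fixes A :: "nat \<Rightarrow> 'a::linorder"
  assumes avoid: "avoids_3_14_2 n A" and lev: "interval_levels n A"
    and pos: "1 \<le> i" "i < x" "x < y" "y < j" "j \<le> n"
    and val: "A x < A j" "A j < A i" "A i < A y"
  shows "\<exists>z. i < z \<and> z < j \<and> A j < A z \<and> A z < A i"
proof -
  define b where "b = Max {p \<in> {x..y}. A p \<le> A j}"
  have "x \<in> {p \<in> {x..y}. A p \<le> A j}"
    using pos val by auto
  then have "b \<in> {p \<in> {x..y}. A p \<le> A j}"
    unfolding b_def by (intro Max_in) auto
  moreover from this have "b \<noteq> y"
    using val by auto
  ultimately have b: "x \<le> b" "b < y" "A b \<le> A j"
    by auto
  have "p \<le> b" if "p \<in> {p \<in> {x..y}. A p \<le> A j}" for p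
    unfolding b_def using that by (intro Max_ge) auto
  from this[of "b + 1"] have above: "A j < A (b + 1)"
    using b by force
  \<comment> \<open>A tie would make \<open>A\<close> constant from \<open>b\<close> to
    \<open>j\<close>, contradicting \<open>above\<close>.\<close>
  have "A b \<noteq> A j"
    using interval_levelsD[OF lev, of b j "b + 1"] above b pos by auto
  then have "A b < A j" "i < b" "b + 1 < j"
    using b pos by auto
  then have "\<not> A i < A (b + 1)"
    using avoid pos val unfolding avoids_3_14_2_def by blast
  \<comment> \<open>A tie would force \<open>A x = A i\<close>, since \<open>x\<close> lies between
    \<open>i\<close> and \<open>b + 1\<close>.\<close>
  moreover have "A i \<noteq> A (b + 1)"
    using interval_levelsD[OF lev, of i "b + 1" x] b pos val by auto
  ultimately show ?thesis
    using above b pos by (intro exI[of _ "b + 1"]) auto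
qed

text \<open>Negating the values exchanges high and low and turns 2-41-3 into 3-14-2, which reduces
  the claim to the ascending case.\<close>

lemma intermediate_descending:
  fixes A :: "nat \<Rightarrow> nat"
  assumes avoid: "avoids_2_41_3 n A" and lev: "interval_levels n A"
    and pos: "1 \<le> i" "i < y" "y < x" "x < j" "j \<le> n"
    and val: "A x < A i" "A i < A j" "A j < A y"
  shows "\<exists>z. i < z \<and> z < j \<and> A i < A z \<and> A z < A j"
proof -
  have "avoids_3_14_2 n (\<lambda>p. - int (A p))"
    using avoid unfolding avoids_3_14_2_def avoids_2_41_3_def by auto
  moreover have "interval_levels n (\<lambda>p. - int (A p))"
    using lev unfolding interval_levels_def neg_equal_iff_equal of_nat_eq_iff .
  ultimately have "\<exists>z. i < z \<and> z < j \<and> - int (A j) < - int (A z) \<and> - int (A z) < - int (A i)"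
    using pos val by (intro intermediate_ascending[of n _ i y x j]) auto
  then show ?thesis by auto
qed

section \<open>Relative order from extremal positions\<close>

lemma same_order:
  fixes A B :: "nat \<Rightarrow> nat"
  assumes A: "avoids_3_14_2 n A" "avoids_2_41_3 n A" "interval_levels n A"
    and B: "avoids_3_14_2 n B" "avoids_2_41_3 n B" "interval_levels n B"
    and mins: "\<And>i j. 1 \<le> i \<Longrightarrow> i \<le> j \<Longrightarrow> j \<le> n \<Longrightarrow>
      {p \<in> {i..j}. A p = Min (A ` {i..j})} = {p \<in> {i..j}. B p = Min (B ` {i..j})}"
    and maxs: "\<And>i j. 1 \<le> i \<Longrightarrow> i \<le> j \<Longrightarrow> j \<le> n \<Longrightarrow>
      {p \<in> {i..j}. A p = Max (A ` {i..j})} = {p \<in> {i..j}. B p = Max (B ` {i..j})}"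
    and "1 \<le> i" "i \<le> j" "j \<le> n"
  shows "(A i < A j \<longleftrightarrow> B i < B j) \<and> (A j < A i \<longleftrightarrow> B j < B i)"
  using \<open>1 \<le> i\<close> \<open>i \<le> j\<close> \<open>j \<le> n\<close>
proof (induction "j - i" arbitrary: i j rule: less_induct)
  case less
  let ?S = "{i..j}"
  have min_iff: "A p = Min (A ` ?S) \<longleftrightarrow> B p = Min (B ` ?S)" if "p \<in> ?S" for p
    using mins[of i j] less.prems that by blast
  have max_iff: "A p = Max (A ` ?S) \<longleftrightarrow> B p = Max (B ` ?S)" if "p \<in> ?S" for p
    using maxs[of i j] less.prems that by blast
  have ij: "i \<in> ?S" "j \<in> ?S"
    using less.prems by auto
  have bounds: "Min (C ` ?S) \<le> C p" "C p \<le> Max (C ` ?S)" if "p \<in> ?S" for C :: "nat \<Rightarrow> nat" and p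
    using that by auto
  consider (min) "A i = Min (A ` ?S) \<or> A j = Min (A ` ?S)"
    | (max) "A i = Max (A ` ?S) \<or> A j = Max (A ` ?S)"
    | (inner) "A i \<noteq> Min (A ` ?S)" "A j \<noteq> Min (A ` ?S)" "A i \<noteq> Max (A ` ?S)" "A j \<noteq> Max (A ` ?S)"
    by blast
  then show ?case
  proof cases
    case min
    then show ?thesis
      using min_iff[OF ij(1)] min_iff[OF ij(2)] bounds(1)[OF ij(1), of A] bounds(1)[OF ij(2), of A]
        bounds(1)[OF ij(1), of B] bounds(1)[OF ij(2), of B]
      by linarith
  next
    case max
    then show ?thesis
      using max_iff[OF ij(1)] max_iff[OF ij(2)] bounds(2)[OF ij(1), of A] bounds(2)[OF ij(2), of A]
        bounds(2)[OF ij(1), of B] bounds(2)[OF ij(2), of B]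
      by linarith
  next
    case inner
    have "Min (A ` ?S) \<in> A ` ?S" "Max (A ` ?S) \<in> A ` ?S"
      using ij by (auto intro!: Min_in Max_in)
    then obtain x y where x: "x \<in> ?S" "A x = Min (A ` ?S)" and y: "y \<in> ?S" "A y = Max (A ` ?S)"
      by force
    \<comment> \<open>The same \<open>x\<close> and \<open>y\<close> are extremal for
      \<open>B\<close>, so the intermediate value lemmas apply to both arrays in the same
      case.\<close>
    have xB: "B x = Min (B ` ?S)" and yB: "B y = Max (B ` ?S)"
      using min_iff max_iff x y by auto
    have Avals: "A x < A i" "A x < A j" "A i < A y" "A j < A y"
      using x y inner bounds[OF ij(1), of A] bounds[OF ij(2), of A] by linarith+
    have "B i \<noteq> Min (B ` ?S)" "B j \<noteq> Min (B ` ?S)" "B i \<noteq> Max (B ` ?S)" "B j \<noteq> Max (B ` ?S)"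
      using inner min_iff max_iff ij by auto
    then have Bvals: "B x < B i" "B x < B j" "B i < B y" "B j < B y"
      using xB yB bounds[OF ij(1), of B] bounds[OF ij(2), of B] by linarith+
    have "x \<noteq> i" "x \<noteq> j" "y \<noteq> i" "y \<noteq> j" "x \<noteq> y"
      using Avals by auto
    then have xy: "i < x" "x < j" "i < y" "y < j" "x \<noteq> y"
      using x y by auto
    \<comment> \<open>A tie would make the array constant on the interval, but the value at
      \<open>x\<close> is smaller. Without ties, one strict comparison decides the other.\<close>
    have neq: "A i \<noteq> A j" "B i \<noteq> B j"
      using interval_levelsD[OF A(3), of i j x] interval_levelsD[OF B(3), of i j x]
        Avals Bvals less.prems xy by auto
    have IH: "(A i < A z \<longleftrightarrow> B i < B z) \<and> (A z < A i \<longleftrightarrow> B z < B i) \<and>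
        (A z < A j \<longleftrightarrow> B z < B j) \<and> (A j < A z \<longleftrightarrow> B j < B z)" if "i < z" "z < j" for z
      using less.hyps[of z i] less.hyps[of j z] less.prems that by auto
    show ?thesis
    proof (cases "x < y")
      case True
      have "B j < B i" if "A j < A i"
      proof -
        have "\<exists>z. i < z \<and> z < j \<and> A j < A z \<and> A z < A i"
          by (rule intermediate_ascending[OF A(1,3), of i x y j])
            (use that Avals less.prems xy True in simp_all)
        then obtain z where "i < z" "z < j" "A j < A z" "A z < A i"
          by blast
        then show ?thesis
          using IH[of z] by linarith
      qed
      \<comment> \<open>The converse takes its witness from \<open>B\<close> and carries it back to
        \<open>A\<close>.\<close>
      moreover have "A j < A i" if "B j < B i"
      proof -
        have "\<exists>z. i < z \<and> z < j \<and> B j < B z \<and> B z < B i"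
          by (rule intermediate_ascending[OF B(1,3), of i x y j])
            (use that Bvals less.prems xy True in simp_all)
        then obtain z where "i < z" "z < j" "B j < B z" "B z < B i"
          by blast
        then show ?thesis
          using IH[of z] by linarith
      qed
      ultimately show ?thesis
        using neq by linarith
    next
      case False
      then have "y < x"
        using xy by simp
      have "B i < B j" if "A i < A j"
      proof -
        have "\<exists>z. i < z \<and> z < j \<and> A i < A z \<and> A z < A j"
          by (rule intermediate_descending[OF A(2,3), of i y x j])
            (use that Avals less.prems xy \<open>y < x\<close> in simp_all)
        then obtain z where "i < z" "z < j" "A i < A z" "A z < A j"
          by blast
        then show ?thesis
          using IH[of z] by linarith
      qed
      moreover have "A i < A j" if "B i < B j"
      proof -
        have "\<exists>z. i < z \<and> z < j \<and> B i < B z \<and> B z < B j"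
          by (rule intermediate_descending[OF B(2,3), of i y x j])
            (use that Bvals less.prems xy \<open>y < x\<close> in simp_all)
        then obtain z where "i < z" "z < j" "B i < B z" "B z < B j"
          by blast
        then show ?thesis
          using IH[of z] by linarith
      qed
      ultimately show ?thesis
        using neq by linarith
    qed
  qed
qed

section \<open>Extremal positions from query answers\<close>

text \<open>Clamping \<open>q\<close> at the length only repeats the last entry, so the answers over
  all \<open>q\<close> list the whole set. For an empty list the right side would still contain a
  default value.\<close>

lemma set_eq_clamped_nth:
  assumes "ps \<noteq> []"
  shows "set ps = (\<lambda>q. ps ! (min q (length ps) - 1)) ` {1..}"
proof (intro equalityI subsetI)
  fix p assume "p \<in> set ps"
  then obtain l where "l < length ps" "p = ps ! l"
    by (auto simp: in_set_conv_nth)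
  then have "p = ps ! (min (Suc l) (length ps) - 1)"
    by simp
  then show "p \<in> (\<lambda>q. ps ! (min q (length ps) - 1)) ` {1..}"
    by (intro image_eqI[of _ _ "Suc l"]) auto
next
  fix p assume "p \<in> (\<lambda>q. ps ! (min q (length ps) - 1)) ` {1..}"
  then obtain q where "q \<ge> 1" "p = ps ! (min q (length ps) - 1)"
    by auto
  moreover have "min q (length ps) - 1 < length ps"
    using assms by (cases ps) auto
  ultimately show "p \<in> set ps"
    by simp
qed

lemma min_positions_eq_RMin:
  assumes "i \<le> j"
  shows "{p \<in> {i..j}. A p = Min (A ` {i..j})} = RMin A i j ` {1..}"
proof -
  have "Min (A ` {i..j}) \<in> A ` {i..j}"
    using assms by (intro Min_in) auto
  then have "{p \<in> {i..j}. A p = Min (A ` {i..j})} \<noteq> {}"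
    by force
  then have "min_positions A i j \<noteq> []"
    by (simp add: min_positions_def)
  from set_eq_clamped_nth[OF this] show ?thesis
    by (simp add: RMin_def[abs_def] Let_def) (simp add: min_positions_def)
qed

lemma max_positions_eq_RMax:
  assumes "i \<le> j"
  shows "{p \<in> {i..j}. A p = Max (A ` {i..j})} = RMax A i j ` {1..}"
proof -
  have "Max (A ` {i..j}) \<in> A ` {i..j}"
    using assms by (intro Max_in) auto
  then have "{p \<in> {i..j}. A p = Max (A ` {i..j})} \<noteq> {}"
    by force
  then have "max_positions A i j \<noteq> []"
    by (simp add: max_positions_def)
  from set_eq_clamped_nth[OF this] show ?thesis
    by (simp add: RMax_def[abs_def] Let_def) (simp add: max_positions_def)
qed

section \<open>Arrays as stretched Baxter permutations\<close>

text \<open>Strict sortedness makes the elements up to entry \<open>l\<close> exactly the entries 0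
  to \<open>l\<close>. This evaluates the counting function \<open>g\<close> below.\<close>

lemma card_le_sorted_list_nth:
  assumes "finite S" "l < card S"
  shows "card {q \<in> S. q \<le> sorted_list_of_set S ! l} = l + 1"
proof -
  let ?xs = "sorted_list_of_set S"
  have len: "length ?xs = card S"
    by simp
  have "{q \<in> S. q \<le> ?xs ! l} = (\<lambda>k. ?xs ! k) ` {..l}"
  proof (intro equalityI subsetI)
    fix q assume q: "q \<in> {q \<in> S. q \<le> ?xs ! l}"
    then have "q \<in> set ?xs"
      using assms by simp
    then obtain k where k: "k < card S" "q = ?xs ! k"
      using len by (metis in_set_conv_nth)
    have "k \<le> l"
    proof (rule ccontr)
      assume "\<not> k \<le> l"
      then have "?xs ! l < ?xs ! k"
        using k sorted_wrt_nth_less[OF strict_sorted_list_of_set[of S], of l k] by simp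
      then show False
        using q k by auto
    qed
    then show "q \<in> (\<lambda>k. ?xs ! k) ` {..l}"
      using k by auto
  next
    fix q assume "q \<in> (\<lambda>k. ?xs ! k) ` {..l}"
    then obtain k where k: "k \<le> l" "q = ?xs ! k"
      by auto
    then have "q \<in> set ?xs" "q \<le> ?xs ! l"
      using assms len by (auto intro: sorted_nth_mono simp del: set_sorted_list_of_set)
    then show "q \<in> {q \<in> S. q \<le> ?xs ! l}"
      using assms by simp
  qed
  moreover have "inj_on (\<lambda>k. ?xs ! k) {..l}"
    using assms len by (intro inj_onI) (simp add: nth_eq_iff_index_eq)
  ultimately show ?thesis
    by (simp add: card_image)
qed

text \<open>Here \<open>g p\<close> is the number of positions outside \<open>P\<close> up to \<open>p\<close>.\<close>
lemma baxter_arrays_factor: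
  assumes "A \<in> baxter_arrays n"
  obtains m \<pi> g where "baxter m \<pi>" "mono g" "g ` {1..n} = {1..m}" "\<And>p. g (p + 1) \<le> g p + 1"
    "\<And>p. p \<in> {1..n} \<Longrightarrow> A p = \<pi> (g p)"
proof -
  from assms obtain k P \<pi> where k: "k < n" and P: "P \<subseteq> {2..n}" "card P = k"
    and bax: "baxter (n - k) \<pi>"
    and list: "map A (sorted_list_of_set ({1..n} - P)) = map \<pi> [1..<n - k + 1]"
    and fill: "\<And>p. p \<in> P \<Longrightarrow> A p = A (Max {p' \<in> {1..n} - P. p' < p})"
    unfolding baxter_arrays_def by blast
  define S where "S = {1..n} - P"
  define g where "g p = card {q \<in> S. q \<le> p}" for p
  have fin: "finite S"
    by (simp add: S_def)
  have "P \<subseteq> {1..n}"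
    using P by auto
  then have cardS: "card S = n - k"
    using P finite_subset[of P "{1..n}"] by (simp add: S_def card_Diff_subset)
  \<comment> \<open>Position 1 is never in \<open>P\<close>; hence the maximum in the fill rule is
    over a nonempty set and \<open>g\<close> is positive on \<open>{1..n}\<close>.\<close>
  have one: "1 \<in> S"
    using P k by (auto simp: S_def)
  have mono: "mono g"
    unfolding g_def using fin by (intro monoI card_mono) auto
  have g_nth: "g (sorted_list_of_set S ! l) = l + 1" if "l < n - k" for l
    unfolding g_def using card_le_sorted_list_nth[OF fin] cardS that by simp
  have A_nth: "A (sorted_list_of_set S ! l) = \<pi> (l + 1)" if "l < n - k" for l
  proof -
    have "map A (sorted_list_of_set S) ! l = map \<pi> [1..<n - k + 1] ! l"
      using list by (simp add: S_def)
    then show ?thesis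
      using that cardS by (simp del: upt_Suc)
  qed
  have on_S: "A p = \<pi> (g p)" if "p \<in> S" for p
  proof -
    have "p \<in> set (sorted_list_of_set S)"
      using that fin by simp
    then obtain l where "l < n - k" "p = sorted_list_of_set S ! l"
      using cardS by (metis in_set_conv_nth length_sorted_list_of_set)
    then show ?thesis
      using g_nth A_nth by simp
  qed
  \<comment> \<open>No element of \<open>S\<close> lies after \<open>q\<close> and up to
    \<open>p\<close>, so \<open>g\<close> does not change between the source of a copy and the
    copy.\<close>
  have on_P: "A p = \<pi> (g p)" if "p \<in> P" for p
  proof -
    define q where "q = Max {p' \<in> S. p' < p}"
    have "1 < p" "p \<notin> S"
      using that P by (auto simp: S_def)
    then have "q \<in> {p' \<in> S. p' < p}"
      unfolding q_def using fin one by (intro Max_in) auto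
    then have "q \<in> S" "q < p"
      by auto
    have "{r \<in> S. r \<le> p} = {r \<in> S. r \<le> q}"
    proof (intro equalityI subsetI)
      fix r assume "r \<in> {r \<in> S. r \<le> p}"
      then have "r \<in> {p' \<in> S. p' < p}"
        using \<open>p \<notin> S\<close> by (auto simp: le_less)
      then show "r \<in> {r \<in> S. r \<le> q}"
        unfolding q_def using fin by auto
    qed (use \<open>q < p\<close> in auto)
    then have "g p = g q"
      by (simp add: g_def)
    then show ?thesis
      using fill[OF that] on_S[OF \<open>q \<in> S\<close>] by (simp add: q_def S_def)
  qed
  have step: "g (p + 1) \<le> g p + 1" for p
  proof -
    have "{q \<in> S. q \<le> p + 1} \<subseteq> insert (p + 1) {q \<in> S. q \<le> p}"
      by auto
    then have "g (p + 1) \<le> card (insert (p + 1) {q \<in> S. q \<le> p})"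
      unfolding g_def using fin by (intro card_mono) auto
    also have "\<dots> \<le> g p + 1"
      unfolding g_def using fin by (simp add: card_insert_if)
    finally show ?thesis .
  qed
  have "g ` {1..n} = {1..n - k}"
  proof (intro equalityI subsetI)
    fix r assume "r \<in> g ` {1..n}"
    then obtain p where p: "p \<in> {1..n}" "r = g p"
      by auto
    have "g p \<le> card S"
      unfolding g_def using fin by (intro card_mono) auto
    moreover have "g p > 0"
      unfolding g_def using fin one p by (auto simp: card_gt_0_iff)
    ultimately show "r \<in> {1..n - k}"
      using p cardS by simp
  next
    fix r assume r: "r \<in> {1..n - k}"
    let ?p = "sorted_list_of_set S ! (r - 1)"
    have "?p \<in> set (sorted_list_of_set S)"
      using r cardS by (intro nth_mem) auto
    then have "?p \<in> {1..n}"
      using fin by (simp add: S_def)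
    moreover have "r = g ?p"
      using g_nth[of "r - 1"] r by auto
    ultimately show "r \<in> g ` {1..n}"
      by blast
  qed
  moreover have "A p = \<pi> (g p)" if "p \<in> {1..n}" for p
    using on_S on_P that by (cases "p \<in> P") (auto simp: S_def)
  ultimately show thesis
    using that bax mono step by blast
qed

text \<open>All four are read off \<open>A p = \<pi> (g p)\<close>. As \<open>g\<close> is monotone
  with steps of at most 1, adjacent positions with distinct values go to adjacent positions of
  \<open>\<pi>\<close>.\<close>

lemma baxter_arrays_properties:
  assumes "A \<in> baxter_arrays n"
  shows "avoids_3_14_2 n A" "avoids_2_41_3 n A" "interval_levels n A" "\<exists>m. A ` {1..n} = {1..m}"
proof -
  obtain m \<pi> g where bax: "baxter m \<pi>" and mono: "mono g" and img: "g ` {1..n} = {1..m}"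
    and step: "\<And>p. g (p + 1) \<le> g p + 1" and A: "\<And>p. p \<in> {1..n} \<Longrightarrow> A p = \<pi> (g p)"
    using baxter_arrays_factor[OF assms] by metis
  have perm: "\<pi> permutes {1..m}"
    using bax by (simp add: baxter_def)
  have g_le: "g p \<le> g q" if "p \<le> q" for p q
    using mono that by (rule monoD)
  have g_in: "1 \<le> g p" "g p \<le> m" if "p \<in> {1..n}" for p
    using img that by auto
  text \<open>An occurrence of a pattern in \<open>A\<close> has distinct values, so \<open>g\<close> maps it to an occurrence in \<open>\<pi>\<close>.\<close>
  have transfer: "1 \<le> g a \<and> g a < g b \<and> g b + 1 < g c \<and> g c \<le> m \<and> g (b + 1) = g b + 1"
    if "1 \<le> a" "a < b" "b + 1 < c" "c \<le> n" "A a \<noteq> A b" "A b \<noteq> A (b + 1)" "A (b + 1) \<noteq> A c" for a b c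
  proof -
    have "g a \<noteq> g b" "g b \<noteq> g (b + 1)" "g (b + 1) \<noteq> g c"
      using A[of a] A[of b] A[of "b + 1"] A[of c] that by auto
    then show ?thesis
      using g_le[of a b] g_le[of b "b + 1"] g_le[of "b + 1" c] step[of b] g_in[of a] g_in[of c] that
      by auto
  qed
  have A': "A a = \<pi> (g a) \<and> A b = \<pi> (g b) \<and> A (b + 1) = \<pi> (g (b + 1)) \<and> A c = \<pi> (g c)"
    if "1 \<le> a" "a < b" "b + 1 < c" "c \<le> n" for a b c
    using that by (intro conjI A) auto
  show "avoids_3_14_2 n A"
    unfolding avoids_3_14_2_def
  proof (intro allI impI notI)
    fix a b c assume pos: "1 \<le> a" "a < b" "b + 1 < c" "c \<le> n"
      and pat: "A b < A c \<and> A c < A a \<and> A a < A (b + 1)"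
    then have "1 \<le> g a \<and> g a < g b \<and> g b + 1 < g c \<and> g c \<le> m \<and> g (b + 1) = g b + 1"
      by (intro transfer) auto
    then show False
      using bax pat A'[OF pos] unfolding baxter_def by metis
  qed
  show "avoids_2_41_3 n A"
    unfolding avoids_2_41_3_def
  proof (intro allI impI notI)
    fix a b c assume pos: "1 \<le> a" "a < b" "b + 1 < c" "c \<le> n"
      and pat: "A (b + 1) < A a \<and> A a < A c \<and> A c < A b"
    then have "1 \<le> g a \<and> g a < g b \<and> g b + 1 < g c \<and> g c \<le> m \<and> g (b + 1) = g b + 1"
      by (intro transfer) auto
    then show False
      using bax pat A'[OF pos] unfolding baxter_def by metis
  qed
  show "interval_levels n A"
    unfolding interval_levels_def
  proof (intro allI impI)
    fix i p j assume pos: "1 \<le> i" "i \<le> p" "p \<le> j" "j \<le> n" and eq: "A i = A j"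
    then have "\<pi> (g i) = \<pi> (g j)"
      using A[of i] A[of j] by auto
    then have "g i = g j"
      using permutes_inj[OF perm] by (simp add: inj_eq)
    then have "g p = g i"
      using g_le[of i p] g_le[of p j] pos by simp
    then show "A p = A i"
      using A[of p] A[of i] pos by auto
  qed
  have "A ` {1..n} = \<pi> ` g ` {1..n}"
    using A by (auto simp: image_image)
  then show "\<exists>m. A ` {1..n} = {1..m}"
    using img permutes_image[OF perm] by auto
qed

section \<open>Values from relative order\<close>

text \<open>No value of \<open>{1..m}\<close> is skipped, so an entry equals the number of distinct
  values up to it, a quantity that depends on the relative order alone.\<close>

lemma rank_eq_value:
  fixes A :: "nat \<Rightarrow> nat"
  assumes "A ` S = {1..m}" "p \<in> S"
  shows "card (A ` {q \<in> S. A q \<le> A p}) = A p"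
proof -
  have "A p \<le> m"
    using assms by auto
  moreover have "A ` {q \<in> S. A q \<le> A p} = {r \<in> A ` S. r \<le> A p}"
    by auto
  ultimately have "A ` {q \<in> S. A q \<le> A p} = {1..A p}"
    using assms by auto
  then show ?thesis by simp
qed

text \<open>Sending \<open>f p\<close> to \<open>g p\<close> is well defined and injective because
  the fibres of \<open>f\<close> and \<open>g\<close> on \<open>S\<close> coincide;
  \<open>inv_into\<close> picks a representative of each fibre.\<close>

lemma card_image_eq_if_same_kernel:
  assumes "\<And>p q. p \<in> S \<Longrightarrow> q \<in> S \<Longrightarrow> f p = f q \<longleftrightarrow> g p = g q"
  shows "card (f ` S) = card (g ` S)"
proof -
  have "(g \<circ> inv_into S f) (f p) = g p" if "p \<in> S" for p
    using assms[of "inv_into S f (f p)" p] that by (simp add: inv_into_into f_inv_into_f)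
  then have "bij_betw (g \<circ> inv_into S f) (f ` S) (g ` S)"
    using assms by (intro bij_betwI') auto
  then show ?thesis
    by (rule bij_betw_same_card)
qed

lemma baxter_arrays_eqI:
  assumes A: "A \<in> baxter_arrays n" and B: "B \<in> baxter_arrays n"
    and RMin: "\<And>i j q. 1 \<le> i \<Longrightarrow> i \<le> j \<Longrightarrow> j \<le> n \<Longrightarrow> 1 \<le> q \<Longrightarrow> RMin A i j q = RMin B i j q"
    and RMax: "\<And>i j q. 1 \<le> i \<Longrightarrow> i \<le> j \<Longrightarrow> j \<le> n \<Longrightarrow> 1 \<le> q \<Longrightarrow> RMax A i j q = RMax B i j q"
  shows "A = B"
proof -
  note propA = baxter_arrays_properties[OF A] and propB = baxter_arrays_properties[OF B]
  have ordered: "(A i < A j \<longleftrightarrow> B i < B j) \<and> (A j < A i \<longleftrightarrow> B j < B i)"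
    if "1 \<le> i" "i \<le> j" "j \<le> n" for i j
  proof (rule same_order[OF propA(1,2,3) propB(1,2,3) _ _ that])
    fix i j :: nat assume ij: "1 \<le> i" "i \<le> j" "j \<le> n"
    show "{p \<in> {i..j}. A p = Min (A ` {i..j})} = {p \<in> {i..j}. B p = Min (B ` {i..j})}"
      unfolding min_positions_eq_RMin[OF ij(2)] using RMin ij by (intro image_cong) auto
    show "{p \<in> {i..j}. A p = Max (A ` {i..j})} = {p \<in> {i..j}. B p = Max (B ` {i..j})}"
      unfolding max_positions_eq_RMax[OF ij(2)] using RMax ij by (intro image_cong) auto
  qed
  have less_iff: "A i < A j \<longleftrightarrow> B i < B j" if "i \<in> {1..n}" "j \<in> {1..n}" for i j
    using ordered[of i j] ordered[of j i] that by (cases "i \<le> j") auto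
  have eq_iff: "A i = A j \<longleftrightarrow> B i = B j" if "i \<in> {1..n}" "j \<in> {1..n}" for i j
    using less_iff[of i j] less_iff[of j i] that by (metis linorder_neq_iff)
  obtain m m' where img: "A ` {1..n} = {1..m}" "B ` {1..n} = {1..m'}"
    using propA(4) propB(4) by auto
  have "A p = B p" if p: "p \<in> {1..n}" for p
  proof -
    have "{q \<in> {1..n}. A q \<le> A p} = {q \<in> {1..n}. B q \<le> B p}"
      using less_iff[OF p] by (metis (lifting) linorder_not_less)
    \<comment> \<open>Entries may repeat, so values are counted rather than positions; the equality
      pattern is the same in both arrays.\<close>
    moreover have "card (A ` {q \<in> {1..n}. A q \<le> A p}) = card (B ` {q \<in> {1..n}. A q \<le> A p})"
      using eq_iff by (intro card_image_eq_if_same_kernel) auto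
    ultimately show ?thesis
      using rank_eq_value[OF img(1) p] rank_eq_value[OF img(2) p] by simp
  qed
  moreover have "A \<in> extensional {1..n}" "B \<in> extensional {1..n}"
    using A B by (auto simp: baxter_arrays_def)
  ultimately show ?thesis
    by (intro extensionalityI) auto
qed

theorem theorem4:
  fixes n :: nat
  assumes "n \<ge> 2"
  shows "(\<exists>reconstruct. \<forall>A \<in> baxter_arrays n. reconstruct (answers n A) = A) \<and>
         (\<forall>A \<in> baxter_arrays n. \<forall>B \<in> baxter_arrays n. A \<noteq> B \<longrightarrow>
            (\<exists>i j q. 1 \<le> i \<and> i \<le> j \<and> j \<le> n \<and> 1 \<le> q \<and>
               (RMin A i j q \<noteq> RMin B i j q \<or> RMax A i j q \<noteq> RMax B i j q)))"
proof
  have "inj_on (answers n) (baxter_arrays n)"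
  proof (rule inj_onI)
    fix A B assume AB: "A \<in> baxter_arrays n" "B \<in> baxter_arrays n" and eq: "answers n A = answers n B"
    have same: "RMin A i j q = RMin B i j q \<and> RMax A i j q = RMax B i j q"
      if "1 \<le> i" "i \<le> j" "j \<le> n" "1 \<le> q" for i j q
      \<comment> \<open>The triple lies in \<open>queries n\<close>, where the restricted table
        holds the actual answers.\<close>
      using fun_cong[OF eq, of "(i, j, q)"] that by (simp add: answers_def queries_def)
    show "A = B"
      using same by (intro baxter_arrays_eqI[OF AB]) auto
  qed
  then show "\<exists>reconstruct. \<forall>A \<in> baxter_arrays n. reconstruct (answers n A) = A"
    by (intro exI[of _ "inv_into (baxter_arrays n) (answers n)"]) (simp add: inv_into_f_f)
  show "\<forall>A \<in> baxter_arrays n. \<forall>B \<in> baxter_arrays n. A \<noteq> B \<longrightarrow>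
            (\<exists>i j q. 1 \<le> i \<and> i \<le> j \<and> j \<le> n \<and> 1 \<le> q \<and>
               (RMin A i j q \<noteq> RMin B i j q \<or> RMax A i j q \<noteq> RMax B i j q))"
    using baxter_arrays_eqI by meson
qed

end
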